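(* Let $\mathsf{n}$ be a linearly dependent tuple of linear subspaces of a finite-dimensional vector space $V$ over a field $\mathbb{K}$. Then $\mathsf{n}$ has a unique inclusion-maximal essential subtuple, and it coincides with the unique subtuple that is minimal by inclusion among the subtuples of $\mathsf{n}$ of minimal defect.
   Context: A tuple is a finite indexed family of linear subspaces of $V$ (repetitions allowed); a subtuple is a subfamily indexed by a subset of the index set. For a tuple $\mathsf{k}$, $\langle\mathsf{k}\rangle=\sum_{L\in\mathsf{k}}L$ (zero for the empty tuple), $\mathfrak{c}(\mathsf{k})$ is the number of its entries, and $\delta(\mathsf{k})=\dim\langle\mathsf{k}\rangle-\mathfrak{c}(\mathsf{k})$ is its defect. A tuple is linearly independent if every subtuple (including itself) has non-negative defect, and linearly dependent otherwise. A tuple is essential if every proper subtuple has strictly higher defect than the whole tuple. "Subtuples of minimal defect" means subtuples $\mathsf{k}\subseteq\mathsf{n}$ with $\delta(\mathsf{k})=\min_{\mathsf{k}'\subseteq\mathsf{n}}\delta(\mathsf{k}')$; among these there is a unique inclusion-minimal one. *)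

theory Defs
  imports Complex_Main "HOL-Library.Set_Algebras"
begin

(* A tuple is a family L restricted to a finite index set I; its subtuples are the restrictions
   of L to the subsets of I. Accordingly inclusion of subtuples is inclusion of index sets,
   and equal subspaces carrying different indices count as different entries. *)

text \<open>The sum over the index set below is the Minkowski sum of the sets \<open>L i\<close>
  (\<open>{0}\<close> for the empty index set).\<close>

definition defect ::
    "('k::field \<Rightarrow> 'v::ab_group_add \<Rightarrow> 'v) \<Rightarrow> ('i \<Rightarrow> 'v set) \<Rightarrow> 'i set \<Rightarrow> int" where
  "defect scale L J = int (vector_space.dim scale (\<Sum>i\<in>J. L i)) - int (card J)"

definition tuple_independent ::
    "('k::field \<Rightarrow> 'v::ab_group_add \<Rightarrow> 'v) \<Rightarrow> ('i \<Rightarrow> 'v set) \<Rightarrow> 'i set \<Rightarrow> bool" where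
  "tuple_independent scale L I \<longleftrightarrow> (\<forall>J\<subseteq>I. 0 \<le> defect scale L J)"

abbreviation tuple_dependent ::
    "('k::field \<Rightarrow> 'v::ab_group_add \<Rightarrow> 'v) \<Rightarrow> ('i \<Rightarrow> 'v set) \<Rightarrow> 'i set \<Rightarrow> bool" where
  "tuple_dependent scale L I \<equiv> \<not> tuple_independent scale L I"

definition essential ::
    "('k::field \<Rightarrow> 'v::ab_group_add \<Rightarrow> 'v) \<Rightarrow> ('i \<Rightarrow> 'v set) \<Rightarrow> 'i set \<Rightarrow> bool" where
  "essential scale L J \<longleftrightarrow> (\<forall>K. K \<subset> J \<longrightarrow> defect scale L J < defect scale L K)"

definition maximal_essential_subtuple ::
    "('k::field \<Rightarrow> 'v::ab_group_add \<Rightarrow> 'v) \<Rightarrow> ('i \<Rightarrow> 'v set) \<Rightarrow> 'i set \<Rightarrow> 'i set \<Rightarrow> bool" where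
  "maximal_essential_subtuple scale L I J \<longleftrightarrow>
     J \<subseteq> I \<and> essential scale L J \<and>
     (\<forall>K. K \<subseteq> I \<and> essential scale L K \<and> J \<subseteq> K \<longrightarrow> K = J)"

definition minimal_defect_subtuple ::
    "('k::field \<Rightarrow> 'v::ab_group_add \<Rightarrow> 'v) \<Rightarrow> ('i \<Rightarrow> 'v set) \<Rightarrow> 'i set \<Rightarrow> 'i set \<Rightarrow> bool" where
  "minimal_defect_subtuple scale L I J \<longleftrightarrow>
     J \<subseteq> I \<and> defect scale L J = Min (defect scale L ` Pow I)"

definition inclusion_minimal_minimal_defect_subtuple ::
    "('k::field \<Rightarrow> 'v::ab_group_add \<Rightarrow> 'v) \<Rightarrow> ('i \<Rightarrow> 'v set) \<Rightarrow> 'i set \<Rightarrow> 'i set \<Rightarrow> bool" where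
  "inclusion_minimal_minimal_defect_subtuple scale L I J \<longleftrightarrow>
     minimal_defect_subtuple scale L I J \<and>
     (\<forall>K. minimal_defect_subtuple scale L I K \<and> K \<subseteq> J \<longrightarrow> K = J)"

end

theory Submission imports Defs begin

text \<open>The defect is submodular by the dimension formula for sums of subspaces. Hence the subtuples
  of minimal defect are closed under intersection and have a least member \<open>M\<close>, which is essential.
  If \<open>E\<close> is essential, then submodularity and the minimality of the defect of \<open>M\<close> show that
  \<open>E \<inter> M\<close> has at most the defect of \<open>E\<close>, so \<open>E \<subseteq> M\<close>.\<close>

text \<open>Turns the Minkowski sum in \<open>defect\<close> into a span, so that
  \<open>span_Un\<close>, \<open>span_mono\<close> and the dimension formula apply. By induction:
  each \<open>L i\<close> is its own span, and the span of a union is the sum of the spans.\<close>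

lemma (in module) sum_subspaces_eq_span:
  assumes "finite J" and "\<And>i. i \<in> J \<Longrightarrow> subspace (L i)"
  shows "(\<Sum>i\<in>J. L i) = span (\<Union>i\<in>J. L i)"
  using assms
proof (induction J rule: finite_induct)
  case empty
  show ?case by (simp add: set_zero)
next
  case (insert i J)
  have "(\<Sum>j\<in>insert i J. L j) = span (L i) + span (\<Union>j\<in>J. L j)"
    using insert by (simp add: span_eq_iff[THEN iffD2])
  also have "\<dots> = span (\<Union>j\<in>insert i J. L j)"
    unfolding UN_insert span_Un set_plus_def by blast
  finally show ?case .
qed

lemma (in finite_dimensional_vector_space) defect_submodular:
  assumes "finite I" and sub: "\<And>i. i \<in> I \<Longrightarrow> subspace (L i)"
    and "A \<subseteq> I" and "B \<subseteq> I"
  shows "defect scale L (A \<union> B) + defect scale L (A \<inter> B) \<le> defect scale L A + defect scale L B"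
proof -
  let ?S = "\<lambda>J. span (\<Union>i\<in>J. L i)"
  have fin: "finite A" "finite B"
    using assms finite_subset by blast+
  have defect_eq: "defect scale L J = int (dim (?S J)) - int (card J)" if "J \<subseteq> I" for J
  proof -
    have "(\<Sum>i\<in>J. L i) = ?S J"
      using that assms(1) sub by (intro sum_subspaces_eq_span) (auto intro: finite_subset)
    then show ?thesis by (simp add: defect_def)
  qed
  have "?S (A \<union> B) = {x + y |x y. x \<in> ?S A \<and> y \<in> ?S B}"
    unfolding UN_Un span_Un ..
  then have "dim (?S (A \<union> B)) + dim (?S A \<inter> ?S B) = dim (?S A) + dim (?S B)"
    by (simp only: dim_sums_Int[OF subspace_span subspace_span])
  \<comment> \<open>The only source of inequality: the spans over \<open>A\<close> and
    \<open>B\<close> may meet in more than the span of their common entries.\<close>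
  moreover have "dim (?S (A \<inter> B)) \<le> dim (?S A \<inter> ?S B)"
    by (intro dim_subset Int_greatest span_mono) auto
  moreover have "card (A \<union> B) + card (A \<inter> B) = card A + card B"
    using card_Un_Int[OF fin] by simp
  moreover have "A \<union> B \<subseteq> I" "A \<inter> B \<subseteq> I"
    using assms by auto
  ultimately show ?thesis
    using assms(3,4) by (simp add: defect_eq)
qed

theorem theorem2p12:
  fixes scale :: "'k::field \<Rightarrow> 'v::ab_group_add \<Rightarrow> 'v"
    and Basis :: "'v set"
    and I :: "'i set"
    and L :: "'i \<Rightarrow> 'v set"
  assumes "finite_dimensional_vector_space scale Basis"
    and "finite I"
    and "\<And>i. i \<in> I \<Longrightarrow> module.subspace scale (L i)"
    and "tuple_dependent scale L I"
  shows "(\<exists>!J. maximal_essential_subtuple scale L I J) \<and>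
         (\<exists>!J. inclusion_minimal_minimal_defect_subtuple scale L I J) \<and>
         (THE J. maximal_essential_subtuple scale L I J) =
         (THE J. inclusion_minimal_minimal_defect_subtuple scale L I J)"
proof -
  interpret finite_dimensional_vector_space scale Basis
    by fact
  let ?d = "defect scale L"
  have submod: "?d (A \<union> B) + ?d (A \<inter> B) \<le> ?d A + ?d B" if "A \<subseteq> I" "B \<subseteq> I" for A B
    using assms(2,3) that by (rule defect_submodular)
  have md_iff: "minimal_defect_subtuple scale L I J \<longleftrightarrow> J \<subseteq> I \<and> (\<forall>K\<subseteq>I. ?d J \<le> ?d K)" for J
    using \<open>finite I\<close> by (auto simp: minimal_defect_subtuple_def intro: Min_eqI[symmetric])
  \<comment> \<open>Least cardinality is used as a stand-in for inclusion-minimality;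
    \<open>M_le\<close> upgrades it to being the least element under inclusion.\<close>
  define M where "M = arg_min card (minimal_defect_subtuple scale L I)"
  have "Min (?d ` Pow I) \<in> ?d ` Pow I"
    using \<open>finite I\<close> by (intro Min_in) auto
  then obtain J0 where "minimal_defect_subtuple scale L I J0"
    unfolding minimal_defect_subtuple_def by auto
  then have M: "minimal_defect_subtuple scale L I M"
    and card_M: "\<And>J. minimal_defect_subtuple scale L I J \<Longrightarrow> card M \<le> card J"
    unfolding M_def by (blast intro: arg_min_natI arg_min_nat_le)+
  then have "M \<subseteq> I" and min_M: "\<And>J. J \<subseteq> I \<Longrightarrow> ?d M \<le> ?d J"
    by (auto simp: md_iff)
  have "finite M"
    using \<open>M \<subseteq> I\<close> \<open>finite I\<close> by (rule finite_subset)
  have M_le: "M \<subseteq> J" if J: "minimal_defect_subtuple scale L I J" for J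
  proof -
    have "J \<subseteq> I" "?d J \<le> ?d M"
      using J \<open>M \<subseteq> I\<close> by (auto simp: md_iff)
    \<comment> \<open>Since \<open>M \<union> J\<close> has at least the defect of \<open>M\<close>,
      submodularity leaves at most \<open>?d J\<close> for \<open>M \<inter> J\<close>.\<close>
    then have "?d (M \<inter> J) \<le> ?d M"
      using submod[of M J] min_M[of "M \<union> J"] \<open>M \<subseteq> I\<close> by simp
    then have "minimal_defect_subtuple scale L I (M \<inter> J)"
      using \<open>M \<subseteq> I\<close> min_M unfolding md_iff by (meson inf.coboundedI1 order_trans)
    \<comment> \<open>A proper subset of the finite set \<open>M\<close> would have fewer elements,
      against the choice of \<open>M\<close>.\<close>
    then have "M \<inter> J = M"
      using card_M \<open>finite M\<close> by (intro card_seteq) auto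
    then show ?thesis by blast
  qed
  have M_essential: "essential scale L M"
    unfolding essential_def
  proof (intro allI impI)
    fix K assume "K \<subset> M"
    \<comment> \<open>If \<open>K\<close> had minimal defect, \<open>M_le\<close> would give
      \<open>M \<subseteq> K\<close>.\<close>
    then have "K \<subseteq> I" and "\<not> minimal_defect_subtuple scale L I K"
      using \<open>M \<subseteq> I\<close> M_le by auto
    then show "?d M < ?d K"
      using min_M unfolding md_iff by (meson not_less order_trans)
  qed
  have essential_le_M: "E \<subseteq> M" if E: "E \<subseteq> I" "essential scale L E" for E
  proof (rule ccontr)
    assume "\<not> E \<subseteq> M"
    \<comment> \<open>Here \<open>E \<inter> M\<close> is a proper subtuple of
      \<open>E\<close>.\<close>
    then have "?d E < ?d (E \<inter> M)"
      using E by (auto simp: essential_def)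
    then show False
      using submod[of E M] min_M[of "E \<union> M"] E \<open>M \<subseteq> I\<close> by simp
  qed
  \<comment> \<open>\<open>M\<close> is essential and contains every essential subtuple, so a
    maximal one can only be \<open>M\<close> itself.\<close>
  have "maximal_essential_subtuple scale L I J \<longleftrightarrow> J = M" for J
    unfolding maximal_essential_subtuple_def
    using \<open>M \<subseteq> I\<close> M_essential essential_le_M by blast
  moreover have "inclusion_minimal_minimal_defect_subtuple scale L I J \<longleftrightarrow> J = M" for J
    unfolding inclusion_minimal_minimal_defect_subtuple_def
    using M M_le by blast
  ultimately show ?thesis by simp
qed

end
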